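(* Let $L\ge1$ be an integer and let $K,K_I\ge0$. Let $g_d,g_1,\dots,g_L$ be mutually independent random variables such that $g_d$ is a unit-mean Rician power random variable with parameter $K$ and $g_1,\dots,g_L$ are identically distributed unit-mean Rician power random variables with parameter $K_I$. Then the interference-limited error vector magnitude $\mathrm{EVM}=\mathbb{E}\left[\sqrt{\left(\sum_{l=1}^L g_l\right)/g_d}\right]$ satisfies $$\mathrm{EVM}=\frac{\sqrt{\pi}\,\Gamma(L+0.5)}{\Gamma(L)}\;{}_1F_1(0.5;\,1;\,-K)\;{}_1F_1(-0.5;\,L;\,-LK_I)\;\sqrt{\frac{1+K}{1+K_I}}.$$
   Context: Unit-mean Rician power random variable with parameter $K\ge0$: a positive random variable with density $$f(x)=(1+K)\,e^{-K}e^{-(1+K)x}\,I_0\!\left(2\sqrt{K(1+K)x}\right),\quad x>0,$$ where $I_0$ is the modified Bessel function of the first kind of order $0$ ($K=0$ is Rayleigh fading, i.e. exponential power with mean $1$). EVM: a desired signal with fading power $g_d$ is received together with $L$ interferers with fading powers $g_1,\dots,g_L$; with unit symbol energy, and in the absence of noise (interference-limited system), the error vector magnitude is $\mathrm{EVM}=\mathbb{E}\left[\sqrt{\left(\sum_{l=1}^L g_l\right)/g_d}\right]$. ${}_1F_1$ is Kummer's confluent hypergeometric function. *)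

theory Defs
  imports "HOL-Probability.Probability"
begin

text \<open>Modified Bessel function of the first kind, of integer order \<open>n\<close>.\<close>

definition bessel_I :: "nat \<Rightarrow> real \<Rightarrow> real" where
  "bessel_I n z = (\<Sum>k. (z / 2) ^ (2 * k + n) / (fact k * fact (k + n)))"

definition kummer_1F1 :: "real \<Rightarrow> real \<Rightarrow> real \<Rightarrow> real" where
  "kummer_1F1 a b z = eval_fps (fps_hypergeo [a] [b] 1) z"

lemma kummer_1F1_altdef:
  "kummer_1F1 a b z = (\<Sum>k. pochhammer a k / pochhammer b k * z ^ k / fact k)"
  by (simp add: kummer_1F1_def eval_fps_def fps_hypergeo_nth)

definition rician_power_density :: "real \<Rightarrow> real \<Rightarrow> real" where
  "rician_power_density K x =
     (if x > 0
      then (1 + K) * exp (- K) * exp (- (1 + K) * x) * bessel_I 0 (2 * sqrt (K * (1 + K) * x))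
      else 0)"

text \<open>
  A random variable with this density is positive almost surely; positivity on the
  remaining null set is not required.
\<close>

definition unit_mean_rician_power :: "'a measure \<Rightarrow> real \<Rightarrow> ('a \<Rightarrow> real) \<Rightarrow> bool" where
  "unit_mean_rician_power M K X \<longleftrightarrow> distributed M lborel X (rician_power_density K)"

lemma bessel_I_0_0: "bessel_I 0 0 = 1"
proof -
  have "(\<lambda>k. (0 / 2 :: real) ^ (2 * k + 0) / (fact k * fact (k + 0))) sums
        (\<Sum>k\<in>{0}. (0 / 2 :: real) ^ (2 * k + 0) / (fact k * fact (k + 0)))"
    by (rule sums_finite) auto
  then show ?thesis by (simp add: bessel_I_def sums_iff)
qed

lemma rician_power_density_rayleigh:
  "x > 0 \<Longrightarrow> rician_power_density 0 x = exponential_density 1 x"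
  by (simp add: rician_power_density_def exponential_density_def bessel_I_0_0)

definition EVM :: "'a measure \<Rightarrow> ('a \<Rightarrow> real) \<Rightarrow> (nat \<Rightarrow> 'a \<Rightarrow> real) \<Rightarrow> nat \<Rightarrow> real" where
  "EVM M gd g L = prob_space.expectation M (\<lambda>\<omega>. sqrt ((\<Sum>l=1..L. g l \<omega>) / gd \<omega>))"

end

theory Submission
  imports Defs
begin

text \<open>
  Expanding \<open>I\<^sub>0\<close> shows that a Rician power is a mixture of Erlang densities of rate \<open>1 + K\<close> whose
  shape is one plus a Poisson variable of mean \<open>K\<close>. Both the shapes and the Poisson means add
  under convolution, so the total interference is again such a mixture, with shape \<open>L\<close> plus a
  Poisson variable of mean \<open>L K\<^sub>I\<close>. By independence the expectation splits into the moment of order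
  \<open>1/2\<close> of the interference and the moment of order \<open>-1/2\<close> of the signal. Integrating term by term,
  each moment is a power series in the Poisson mean with Gamma function quotients as coefficients,
  and Kummer's transformation absorbs the Poisson factor \<open>exp (- m)\<close>.
\<close>

section \<open>Kummer's function: convergence and transformation\<close>

text \<open>Ratio test: the quotient \<open>?r k\<close> of consecutive terms tends to 0 for every
  \<open>z\<close>. Absolute convergence is what the Cauchy product in Kummer's transformation
  requires.\<close>

lemma summable_norm_kummer:
  fixes a b z :: real
  assumes "b > 0"
  shows "summable (\<lambda>k. norm (pochhammer a k / pochhammer b k * z ^ k / fact k))"
proof -
  let ?t = "\<lambda>k. pochhammer a k / pochhammer b k * z ^ k / fact k"
  let ?r = "\<lambda>k::nat. (a + real k) * z / ((b + real k) * (real k + 1))"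
  have "?r \<longlonglongrightarrow> 0"
    by real_asymp
  then have "eventually (\<lambda>k. dist (?r k) 0 < 1 / 2) sequentially"
    by (rule tendstoD) simp
  then obtain N where N: "\<And>k. k \<ge> N \<Longrightarrow> norm (?r k) < 1 / 2"
    by (auto simp: eventually_sequentially dist_norm)
  have Suc: "?t (Suc k) = ?r k * ?t k" for k
    using pochhammer_pos[OF assms, of k] pochhammer_pos[OF assms, of "Suc k"] assms
    by (simp add: pochhammer_Suc field_simps)
  show ?thesis
  proof (rule summable_ratio_test[where c = "1 / 2" and N = N])
    fix k assume "k \<ge> N"
    have "norm (?t (Suc k)) \<le> 1 / 2 * norm (?t k)"
      unfolding Suc norm_mult[of "?r k"]
      using N[OF \<open>k \<ge> N\<close>] by (intro mult_right_mono) auto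
    then show "norm (norm (?t (Suc k))) \<le> 1 / 2 * norm (norm (?t k))"
      by (simp only: real_norm_def abs_idempotent)
  qed simp
qed

lemma kummer_sums:
  assumes "b > 0"
  shows "(\<lambda>k. pochhammer a k / pochhammer b k * z ^ k / fact k) sums kummer_1F1 a b z"
  unfolding kummer_1F1_altdef
  by (intro summable_sums summable_norm_cancel[OF summable_norm_kummer[OF assms]])

lemma kummer_1F1_nonneg:
  assumes "a > 0" "b > 0" "z \<ge> 0"
  shows "kummer_1F1 a b z \<ge> 0"
  using assms pochhammer_pos[of a] pochhammer_pos[of b]
  by (intro sums_le[OF _ sums_zero kummer_sums]) (auto simp: less_imp_le)

text \<open>Multiply the two series. The coefficient of \<open>(- z) ^ n / fact n\<close> in the
  Cauchy product is the terminating Gauss sum 2F1(a, -n; b; 1), which the Chu-Vandermonde identity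
  evaluates.\<close>

theorem kummer_transformation:
  assumes "b > 0"
  shows "exp (- z) * kummer_1F1 a b z = kummer_1F1 (b - a) b (- z)"
proof -
  let ?t = "\<lambda>k. pochhammer a k / pochhammer b k * z ^ k / fact k"
  let ?e = "\<lambda>k. (- z) ^ k /\<^sub>R fact k"
  have coeff: "(\<Sum>i\<le>n. ?t i * ?e (n - i)) = pochhammer (b - a) n / pochhammer b n * (- z) ^ n / fact n"
    for n
  proof -
    have "?t i * ?e (n - i) = (- z) ^ n / fact n *
        (pochhammer a i * pochhammer (- real n) i / (of_nat (fact i) * pochhammer b i))"
      if "i \<le> n" for i
    proof -
      \<comment> \<open>The factor \<open>1 / fact (n - i)\<close> of the exponential series is
        rewritten through \<open>pochhammer (- real n) i\<close>; this creates the upper parameter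
        -n of the Gauss sum.\<close>
      have "pochhammer (- real n) i = (- 1) ^ i * (fact i * real (n choose i))"
        by (simp add: binomial_gbinomial gbinomial_pochhammer flip: power_add mult_2 mult.assoc)
      also have "fact i * real (n choose i) = fact n / fact (n - i)"
        using that by (simp add: binomial_fact)
      finally have "fact n = fact (n - i) * ((- 1) ^ i * pochhammer (- real n) i)"
        by (simp flip: power_add mult_2 mult.assoc)
      moreover from this have "pochhammer (- real n) i \<noteq> 0"
        by (metis fact_nonzero mult_zero_right)
      moreover have "(- z) ^ n = (- 1) ^ i * z ^ i * (- z) ^ (n - i)"
        using that by (metis le_add_diff_inverse power_add power_minus)
      ultimately show ?thesis
        using pochhammer_pos[OF assms, of i]
        by (simp add: field_simps flip: power_add mult_2)
    qed
    then have "(\<Sum>i\<le>n. ?t i * ?e (n - i)) = (- z) ^ n / fact n *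
        (\<Sum>i = 0..n. pochhammer a i * pochhammer (- real n) i / (of_nat (fact i) * pochhammer b i))"
      by (simp add: sum_distrib_left atMost_atLeast0)
    also have "\<dots> = (- z) ^ n / fact n * (pochhammer (b - a) n / pochhammer b n)"
      using assms by (subst Vandermonde_pochhammer) auto
    finally show ?thesis by (simp add: mult_ac)
  qed
  have "kummer_1F1 a b z * exp (- z) = (\<Sum>n. \<Sum>i\<le>n. ?t i * ?e (n - i))"
    unfolding kummer_1F1_altdef exp_def
    by (intro Cauchy_product summable_norm_kummer assms summable_norm_exp)
  also have "\<dots> = kummer_1F1 (b - a) b (- z)"
    unfolding coeff kummer_1F1_altdef ..
  finally show ?thesis by (simp add: mult.commute)
qed

section \<open>Power moments of Erlang densities and of their Poisson mixtures\<close>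

text \<open>The substitution t = l x yields Euler's integral for Gamma; the condition on
  \<open>s\<close> is its convergence at 0, so negative orders are covered.\<close>

lemma nn_integral_erlang_powr_moment:
  fixes s l :: real
  assumes l: "0 < l" and s: "0 < real n + 1 + s"
  shows "(\<integral>\<^sup>+x. ennreal (x powr s) * ennreal (erlang_density n l x) \<partial>lborel) =
    ennreal (Gamma (real n + 1 + s) / (fact n * l powr s))"
proof -
  let ?c = "1 / (fact n * l powr s)"
  let ?G = "\<lambda>t. indicator {0..} t * t powr (real n + 1 + s - 1) / exp t"
  \<comment> \<open>The factor \<open>l\<close> is the Jacobian, and \<open>0 + l * x\<close> has
    the shape expected by the affine change of variables.\<close>
  have eq: "x powr s * erlang_density n l x = l * ?c * ?G (0 + l * x)" if "x \<noteq> 0" for x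
  proof (cases "x > 0")
    case True
    then have "l powr real n = l ^ n" "x powr real n = x ^ n"
      using l by (auto simp: powr_realpow)
    with True l show ?thesis
      by (simp add: erlang_density_def powr_mult powr_add exp_minus field_simps)
  next
    case False
    with that l show ?thesis
      by (auto simp: erlang_density_def indicator_def zero_le_mult_iff)
  qed
  have "(\<integral>\<^sup>+x. ennreal (x powr s) * ennreal (erlang_density n l x) \<partial>lborel) =
        (\<integral>\<^sup>+x. ennreal ?c * (ennreal l * ennreal (?G (0 + l * x))) \<partial>lborel)"
  proof (rule nn_integral_cong_AE)
    show "AE x in lborel. ennreal (x powr s) * ennreal (erlang_density n l x) =
        ennreal ?c * (ennreal l * ennreal (?G (0 + l * x)))"
      using AE_lborel_singleton[of 0]
    proof eventually_elim
      case (elim x)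
      show ?case
        using l eq[OF elim] by (simp add: mult_ac flip: ennreal_mult)
    qed
  qed
  also have "\<dots> = ennreal ?c * (\<integral>\<^sup>+x. ennreal (?G x) \<partial>lborel)"
    using l by (subst nn_integral_real_affine[where c = l and t = 0])
      (auto simp: nn_integral_cmult)
  also have "(\<integral>\<^sup>+x. ennreal (?G x) \<partial>lborel) = ennreal (Gamma (real n + 1 + s))"
    by (rule Gamma_conv_nn_integral_real[OF s, symmetric])
  also have "ennreal ?c * \<dots> = ennreal (Gamma (real n + 1 + s) / (fact n * l powr s))"
    using s l by (simp add: Gamma_real_nonneg flip: ennreal_mult)
  finally show ?thesis .
qed

text \<open>
  The index \<open>n\<close> follows \<^const>\<open>erlang_density\<close>: it is one less than the shape parameter, hence the
  \<open>Suc\<close> in the convolution rule below.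
\<close>

definition erlang_mixture :: "nat \<Rightarrow> real \<Rightarrow> real \<Rightarrow> real \<Rightarrow> ennreal" where
  "erlang_mixture n m l x =
     (\<Sum>k. ennreal (m ^ k / fact k * exp (- m)) * ennreal (erlang_density (n + k) l x))"

lemma erlang_mixture_neg: "x < 0 \<Longrightarrow> erlang_mixture n m l x = 0"
  by (simp add: erlang_mixture_def erlang_density_def)

lemma borel_measurable_erlang_mixture [measurable]: "erlang_mixture n m l \<in> borel_measurable borel"
  unfolding erlang_mixture_def[abs_def] by measurable

text \<open>By monotone convergence the moment is the Poisson average of the Erlang moments.
  Factoring shifted Gamma values into Pochhammer symbols gives 1F1(b + s; b; m) with b = n + 1, and
  the transformation then absorbs \<open>exp (- m)\<close>.\<close>

lemma nn_integral_erlang_mixture_powr_moment: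
  fixes s l :: real
  assumes l: "0 < l" and s: "0 < real n + 1 + s" and m: "0 \<le> m"
  shows "(\<integral>\<^sup>+x. ennreal (x powr s) * erlang_mixture n m l x \<partial>lborel) =
    ennreal (Gamma (real n + 1 + s) / Gamma (real n + 1) * kummer_1F1 (- s) (real n + 1) (- m)
      / l powr s)"
proof -
  let ?b = "real n + 1"
  let ?p = "\<lambda>k. m ^ k / fact k * exp (- m)"
  let ?C = "Gamma (?b + s) / Gamma ?b * exp (- m) / l powr s"
  have "(\<integral>\<^sup>+x. ennreal (x powr s) * erlang_mixture n m l x \<partial>lborel) =
      (\<integral>\<^sup>+x. (\<Sum>k. ennreal (?p k) * (ennreal (x powr s) * ennreal (erlang_density (n + k) l x))) \<partial>lborel)"
    unfolding erlang_mixture_def by (simp add: mult_ac flip: ennreal_suminf_cmult)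
  also have "\<dots> = (\<Sum>k. ennreal (?p k) *
      (\<integral>\<^sup>+x. ennreal (x powr s) * ennreal (erlang_density (n + k) l x) \<partial>lborel))"
    by (simp add: nn_integral_suminf nn_integral_cmult)
  also have "\<dots> = (\<Sum>k. ennreal (?C * (pochhammer (?b + s) k / pochhammer ?b k * m ^ k / fact k)))"
  proof (rule suminf_cong)
    fix k
    have nonpos: "?b + s \<notin> \<int>\<^sub>\<le>\<^sub>0" "?b \<notin> \<int>\<^sub>\<le>\<^sub>0"
      using s by (auto dest: nonpos_Ints_nonpos)
    have "(\<integral>\<^sup>+x. ennreal (x powr s) * ennreal (erlang_density (n + k) l x) \<partial>lborel) =
        ennreal (Gamma (real (n + k) + 1 + s) / (fact (n + k) * l powr s))"
      using s by (intro nn_integral_erlang_powr_moment l) simp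
    moreover have "Gamma (real (n + k) + 1 + s) = Gamma (?b + s) * pochhammer (?b + s) k"
      using pochhammer_Gamma[OF nonpos(1), of k] Gamma_real_pos[OF s] by (simp add: field_simps)
    moreover have "(fact (n + k) :: real) = Gamma ?b * pochhammer ?b k"
      using pochhammer_Gamma[OF nonpos(2), of k] Gamma_real_pos[of ?b] Gamma_fact[of "n + k", where 'a = real]
      by (simp add: field_simps del: Gamma_real_pos)
    ultimately show "ennreal (?p k) * (\<integral>\<^sup>+x. ennreal (x powr s) * ennreal (erlang_density (n + k) l x) \<partial>lborel) =
        ennreal (?C * (pochhammer (?b + s) k / pochhammer ?b k * m ^ k / fact k))"
      using m s pochhammer_pos[of "?b + s" k] pochhammer_pos[of ?b k] Gamma_real_pos[OF s] Gamma_real_pos[of ?b]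
      by (simp add: mult_ac flip: ennreal_mult)
  qed
  also have "\<dots> = ennreal (?C * kummer_1F1 (?b + s) ?b m)"
  proof (rule suminf_ennreal_eq)
    show "0 \<le> ?C * (pochhammer (?b + s) k / pochhammer ?b k * m ^ k / fact k)" for k
      using m s pochhammer_pos[of "?b + s" k] pochhammer_pos[of ?b k] Gamma_real_pos[OF s] Gamma_real_pos[of ?b]
      by simp
    show "(\<lambda>k. ?C * (pochhammer (?b + s) k / pochhammer ?b k * m ^ k / fact k)) sums
        (?C * kummer_1F1 (?b + s) ?b m)"
      by (intro sums_mult kummer_sums) simp
  qed
  also have "?C * kummer_1F1 (?b + s) ?b m =
      Gamma (?b + s) / Gamma ?b * kummer_1F1 (- s) ?b (- m) / l powr s"
    using kummer_transformation[of ?b m "?b + s"] by simp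
  finally show ?thesis .
qed

section \<open>Convolution of Erlang mixtures\<close>

text \<open>Tonelli, with one of the sums read as an integral over counting measure.\<close>

lemma suminf_ennreal_swap:
  fixes f :: "nat \<Rightarrow> nat \<Rightarrow> ennreal"
  shows "(\<Sum>i. \<Sum>j. f i j) = (\<Sum>j. \<Sum>i. f i j)"
  using nn_integral_suminf[of "\<lambda>j i. f i j" "count_space UNIV"]
  by (simp add: nn_integral_count_space_nat)

lemma suminf_ennreal_diagonal:
  fixes f :: "nat \<Rightarrow> nat \<Rightarrow> ennreal"
  shows "(\<Sum>i. \<Sum>j. f i j) = (\<Sum>n. \<Sum>i\<le>n. f i (n - i))"
proof -
  have "(\<Sum>n. \<Sum>i\<le>n. f i (n - i)) = (\<Sum>n. \<Sum>i. if i \<le> n then f i (n - i) else 0)"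
    by (intro suminf_cong, subst suminf_finite[of "{.._}"]) auto
  also have "\<dots> = (\<Sum>i. \<Sum>n. if i \<le> n then f i (n - i) else 0)"
    by (rule suminf_ennreal_swap)
  also have "\<dots> = (\<Sum>i. \<Sum>j. f i j)"
  proof (rule suminf_cong)
    fix i
    \<comment> \<open>The first \<open>i\<close> terms vanish, so shifting the index by
      \<open>i\<close> recovers the full row.\<close>
    have "(\<Sum>n. if i \<le> n then f i (n - i) else 0) =
        (\<Sum>j. if i \<le> j + i then f i (j + i - i) else 0) + (\<Sum>n<i. if i \<le> n then f i (n - i) else 0)"
      by (rule suminf_offset) simp
    then show "(\<Sum>n. if i \<le> n then f i (n - i) else 0) = (\<Sum>j. f i j)"
      by simp
  qed
  finally show ?thesis ..
qed

text \<open>At a common rate, the convolution of two Erlang components depends only on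
  \<open>i + j\<close>. Summing along the diagonals therefore convolves the Poisson weights, and the
  binomial theorem (fact \<open>p\<close>) adds their means.\<close>

lemma convolution_erlang_mixture:
  assumes l: "0 < l" and m: "0 \<le> m" and m': "0 \<le> m'"
  shows "(\<integral>\<^sup>+y. erlang_mixture n m l (x - y) * erlang_mixture n' m' l y \<partial>lborel) =
    erlang_mixture (Suc (n + n')) (m + m') l x"
proof -
  let ?p = "\<lambda>m k. m ^ k / fact k * exp (- m) :: real"
  have p: "(\<Sum>i\<le>k. ennreal (?p m i) * ennreal (?p m' (k - i))) = ennreal (?p (m + m') k)" for k
  proof -
    have "(\<Sum>i\<le>k. ?p m i * ?p m' (k - i)) =
        (\<Sum>i\<le>k. real (k choose i) * m ^ i * m' ^ (k - i)) / fact k * exp (- (m + m'))"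
      unfolding sum_divide_distrib sum_distrib_right
      by (intro sum.cong refl) (simp add: binomial_fact exp_add exp_diff exp_minus field_simps)
    also have "\<dots> = ?p (m + m') k"
      by (simp add: binomial_ring)
    finally show ?thesis
      using m m' by (simp add: sum_ennreal flip: ennreal_mult)
  qed
  have "(\<integral>\<^sup>+y. erlang_mixture n m l (x - y) * erlang_mixture n' m' l y \<partial>lborel) =
      (\<integral>\<^sup>+y. (\<Sum>i. \<Sum>j. ennreal (?p m i) * ennreal (?p m' j) *
        (ennreal (erlang_density (n + i) l (x - y)) * ennreal (erlang_density (n' + j) l y))) \<partial>lborel)"
    unfolding erlang_mixture_def
    by (intro nn_integral_cong)
      (simp add: mult_ac flip: ennreal_suminf_cmult ennreal_suminf_multc)
  also have "\<dots> = (\<Sum>i. \<Sum>j. ennreal (?p m i) * ennreal (?p m' j) *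
      (\<integral>\<^sup>+y. ennreal (erlang_density (n + i) l (x - y)) * ennreal (erlang_density (n' + j) l y) \<partial>lborel))"
    by (simp add: nn_integral_suminf nn_integral_cmult)
  also have "\<dots> = (\<Sum>i. \<Sum>j. ennreal (?p m i) * ennreal (?p m' j) *
      ennreal (erlang_density (Suc (n + n') + (i + j)) l x))"
    using convolution_erlang_density[OF l, THEN fun_cong] by (simp add: ac_simps)
  also have "\<dots> = (\<Sum>k. \<Sum>i\<le>k. ennreal (?p m i) * ennreal (?p m' (k - i)) *
      ennreal (erlang_density (Suc (n + n') + (i + (k - i))) l x))"
    by (rule suminf_ennreal_diagonal)
  also have "\<dots> = erlang_mixture (Suc (n + n')) (m + m') l x"
    unfolding erlang_mixture_def p[symmetric] sum_distrib_right
    by (intro suminf_cong sum.cong refl) simp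
  finally show ?thesis .
qed

text \<open>The induction starts at singletons because an empty sum has no density. The index
  \<open>card I - 1\<close> encodes a base shape of \<open>card I\<close>.\<close>

lemma (in prob_space) distributed_sum_erlang_mixture:
  fixes m l :: real
  assumes "finite I" "I \<noteq> {}" "0 < l" "0 \<le> m"
  assumes "\<And>i. i \<in> I \<Longrightarrow> distributed M lborel (X i) (erlang_mixture 0 m l)"
  assumes "indep_vars (\<lambda>_. borel) X I"
  shows "distributed M lborel (\<lambda>\<omega>. \<Sum>i\<in>I. X i \<omega>) (erlang_mixture (card I - 1) (card I * m) l)"
  using assms
proof (induction rule: finite_ne_induct)
  case (singleton i)
  then show ?case by simp
next
  case (insert i I)
  have card: "Suc (card I - 1) = card (insert i I) - 1" "m + card I * m = card (insert i I) * m"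
    using insert.hyps by (auto simp: card_gt_0_iff algebra_simps)
  have "distributed M lborel (\<lambda>\<omega>. X i \<omega> + (\<Sum>i\<in>I. X i \<omega>)) (\<lambda>x. \<integral>\<^sup>+y. erlang_mixture 0 m l (x - y) *
      erlang_mixture (card I - 1) (card I * m) l y \<partial>lborel)"
  proof (rule distributed_convolution)
    show "indep_var borel (X i) borel (\<lambda>\<omega>. \<Sum>i\<in>I. X i \<omega>)"
      using insert by (intro indep_vars_sum) auto
    show "distributed M lborel (\<lambda>\<omega>. \<Sum>i\<in>I. X i \<omega>) (erlang_mixture (card I - 1) (card I * m) l)"
      using insert by (intro insert.IH) (auto intro: indep_vars_subset)
  qed (use insert in auto)
  then show ?case
    using insert.prems insert.hyps by (simp add: convolution_erlang_mixture card del: card_insert_disjoint One_nat_def)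
qed

section \<open>Rician powers as Erlang mixtures\<close>

text \<open>Of the two factorials in each term of I_0, one goes to the Poisson weight and the other
  to the Erlang density. The point 0 is excluded because there the Rician density is set to 0 while
  the mixture is positive.\<close>

lemma rician_power_density_eq_erlang_mixture:
  assumes "0 \<le> K" "x \<noteq> 0"
  shows "ennreal (rician_power_density K x) = erlang_mixture 0 K (1 + K) x"
proof (cases "x > 0")
  case True
  define y where "y = K * (1 + K) * x"
  have y: "0 \<le> y" using assms True by (simp add: y_def)
  let ?t = "\<lambda>k. y ^ k / (fact k * fact k)"
  \<comment> \<open>The case a = b = 1 is the exponential series, which dominates the Bessel series
    \<open>?t\<close>.\<close>
  have "summable (\<lambda>k. norm (pochhammer 1 k / pochhammer 1 k * y ^ k / fact k))"
    by (rule summable_norm_kummer) simp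
  then have "summable (\<lambda>k. norm (y ^ k / fact k))"
    by (simp add: pochhammer_fact[symmetric])
  then have "summable ?t"
  proof (rule summable_comparison_test')
    show "norm (?t k) \<le> norm (y ^ k / fact k)" for k
      using y divide_left_mono[of "fact k * 1" "fact k * fact k" "y ^ k"] by (simp add: fact_ge_1)
  qed
  moreover have "bessel_I 0 (2 * sqrt y) = (\<Sum>k. ?t k)"
    unfolding bessel_I_def using y by (simp add: power_mult)
  ultimately have "?t sums bessel_I 0 (2 * sqrt y)"
    by (simp add: summable_sums)
  then have "(\<lambda>k. (1 + K) * exp (- K) * exp (- (1 + K) * x) * ?t k) sums rician_power_density K x"
    using True unfolding rician_power_density_def y_def by (simp only: if_True sums_mult)
  moreover have "(1 + K) * exp (- K) * exp (- (1 + K) * x) * ?t k =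
      K ^ k / fact k * exp (- K) * erlang_density (0 + k) (1 + K) x" for k
  proof -
    have "y ^ k = K ^ k * (1 + K) ^ k * x ^ k"
      by (simp add: y_def power_mult_distrib)
    with True show ?thesis by (simp add: erlang_density_def mult_ac)
  qed
  ultimately have "(\<lambda>k. K ^ k / fact k * exp (- K) * erlang_density (0 + k) (1 + K) x)
      sums rician_power_density K x"
    by simp
  then have "(\<Sum>k. ennreal (K ^ k / fact k * exp (- K) * erlang_density (0 + k) (1 + K) x)) =
      ennreal (rician_power_density K x)"
    using assms by (intro suminf_ennreal_eq) auto
  then show ?thesis
    using assms by (simp add: erlang_mixture_def flip: ennreal_mult)
next
  case False
  then show ?thesis
    using assms by (simp add: rician_power_density_def erlang_mixture_neg)
qed

lemma distributed_rician_power: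
  assumes "unit_mean_rician_power M K X" "0 \<le> K"
  shows "distributed M lborel X (erlang_mixture 0 K (1 + K))"
proof -
  have X: "distributed M lborel X (\<lambda>x. ennreal (rician_power_density K x))"
    using assms by (simp add: unit_mean_rician_power_def)
  have "AE x in lborel. ennreal (rician_power_density K x) = erlang_mixture 0 K (1 + K) x"
    using AE_lborel_singleton[of 0] by eventually_elim (simp add: rician_power_density_eq_erlang_mixture assms)
  then show ?thesis
    by (rule iffD1[OF distributed_cong_density X])
      (use distributed_borel_measurable[OF X] in simp_all)
qed

section \<open>Moments of the random variables and the final formula\<close>

lemma (in prob_space) erlang_mixture_powr_moment:
  fixes s l :: real
  assumes X: "distributed M lborel X (erlang_mixture n m l)"
  assumes l: "0 < l" and s: "0 < real n + 1 + s" and m: "0 \<le> m"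
  defines "e \<equiv> Gamma (real n + 1 + s) / Gamma (real n + 1) * kummer_1F1 (- s) (real n + 1) (- m) / l powr s"
  shows "integrable M (\<lambda>\<omega>. X \<omega> powr s)" "expectation (\<lambda>\<omega>. X \<omega> powr s) = e"
proof -
  have [measurable]: "X \<in> borel_measurable M"
    using distributed_measurable[OF X] by simp
  have "(\<integral>\<^sup>+\<omega>. ennreal (X \<omega> powr s) \<partial>M) = ennreal e"
    using distributed_nn_integral[OF X, of "\<lambda>x. ennreal (x powr s)", symmetric]
      nn_integral_erlang_mixture_powr_moment[OF l s m]
    by (simp add: e_def mult.commute)
  moreover have "0 \<le> e"
  proof -
    \<comment> \<open>The sign is hidden at the argument \<open>- m\<close>; transforming back gives
      a series with nonnegative terms. Without \<open>0 \<le> e\<close>, the value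
      \<open>ennreal e\<close> would not determine \<open>e\<close>.\<close>
    have "kummer_1F1 (- s) (real n + 1) (- m) = exp (- m) * kummer_1F1 (real n + 1 + s) (real n + 1) m"
      by (subst kummer_transformation) simp_all
    then show ?thesis
      using s l m by (simp add: e_def kummer_1F1_nonneg)
  qed
  ultimately have "has_bochner_integral M (\<lambda>\<omega>. X \<omega> powr s) e"
    by (intro has_bochner_integral_nn_integral) auto
  then show "integrable M (\<lambda>\<omega>. X \<omega> powr s)" "expectation (\<lambda>\<omega>. X \<omega> powr s) = e"
    by (simp_all add: has_bochner_integral_iff)
qed

theorem corollary3:
  fixes M :: "'a measure" and gd :: "'a \<Rightarrow> real" and g :: "nat \<Rightarrow> 'a \<Rightarrow> real"
    and L :: nat and K K\<^sub>I :: real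
  assumes "prob_space M"
    and "L \<ge> 1" and "K \<ge> 0" and "K\<^sub>I \<ge> 0"
    and "prob_space.indep_vars M (\<lambda>_. borel) (\<lambda>l. if l = 0 then gd else g l) {0..L}"
    and "unit_mean_rician_power M K gd"
    and "\<And>l. l \<in> {1..L} \<Longrightarrow> unit_mean_rician_power M K\<^sub>I (g l)"
  shows "integrable M (\<lambda>\<omega>. sqrt ((\<Sum>l=1..L. g l \<omega>) / gd \<omega>)) \<and>
         EVM M gd g L =
           sqrt pi * Gamma (real L + 1 / 2) / Gamma (real L)
           * kummer_1F1 (1 / 2) 1 (- K)
           * kummer_1F1 (- 1 / 2) (real L) (- real L * K\<^sub>I)
           * sqrt ((1 + K) / (1 + K\<^sub>I))"
proof -
  interpret prob_space M by fact
  \<comment> \<open>Index 0 carries the signal, so splitting \<open>{0..L}\<close> into 0 and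
    \<open>{1..L}\<close> makes \<open>gd\<close> independent of the total interference.\<close>
  define X where "X = (\<lambda>l. if l = 0 then gd else g l)"
  define S where "S = (\<lambda>\<omega>. \<Sum>l=1..L. g l \<omega>)"
  have L: "real (L - 1) + 1 = real L" using \<open>L \<ge> 1\<close> by simp
  have indep: "indep_vars (\<lambda>_. borel) X {0..L}"
    using assms(5) by (simp add: X_def)
  have S_eq: "S = (\<lambda>\<omega>. \<Sum>l\<in>{1..L}. X l \<omega>)"
    unfolding S_def by (intro ext sum.cong) (auto simp: X_def)

  have gd: "distributed M lborel gd (erlang_mixture 0 K (1 + K))"
    using assms by (intro distributed_rician_power)
  have "distributed M lborel S (erlang_mixture (card {1..L} - 1) (card {1..L} * K\<^sub>I) (1 + K\<^sub>I))"
    unfolding S_eq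
  proof (rule distributed_sum_erlang_mixture)
    show "distributed M lborel (X l) (erlang_mixture 0 K\<^sub>I (1 + K\<^sub>I))" if "l \<in> {1..L}" for l
      using that assms(7)[OF that] \<open>K\<^sub>I \<ge> 0\<close> by (auto simp: X_def intro: distributed_rician_power)
    show "indep_vars (\<lambda>_. borel) X {1..L}"
      by (rule indep_vars_subset[OF indep]) auto
  qed (use assms in auto)
  then have S: "distributed M lborel S (erlang_mixture (L - 1) (L * K\<^sub>I) (1 + K\<^sub>I))"
    by simp

  have "indep_var borel (X 0) borel S"
    unfolding S_eq using \<open>L \<ge> 1\<close>
    by (intro indep_vars_sum) (auto intro: indep_vars_subset[OF indep])
  then have "indep_var borel ((\<lambda>x. x powr (- 1 / 2)) \<circ> X 0) borel ((\<lambda>x. x powr (1 / 2)) \<circ> S)"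
    by (rule indep_var_compose) auto
  then have ind: "indep_var borel (\<lambda>\<omega>. gd \<omega> powr (- 1 / 2)) borel (\<lambda>\<omega>. S \<omega> powr (1 / 2))"
    by (simp add: comp_def X_def)

  note S_mom = erlang_mixture_powr_moment[OF S, of "1 / 2", unfolded L]
  note gd_mom = erlang_mixture_powr_moment[OF gd, of "- 1 / 2"]
  have int: "integrable M (\<lambda>\<omega>. gd \<omega> powr (- 1 / 2))" "integrable M (\<lambda>\<omega>. S \<omega> powr (1 / 2))"
    using S_mom(1) gd_mom(1) assms by simp_all
  have ES: "expectation (\<lambda>\<omega>. S \<omega> powr (1 / 2)) =
      Gamma (real L + 1 / 2) / Gamma (real L) * kummer_1F1 (- 1 / 2) (real L) (- real L * K\<^sub>I) / sqrt (1 + K\<^sub>I)"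
    using S_mom(2) assms by (simp add: powr_half_sqrt)
  \<comment> \<open>Here the index is 0 and the order is -1/2: Gamma(1/2) supplies
    \<open>sqrt pi\<close>, and dividing by \<open>(1 + K) powr (- 1 / 2)\<close> puts
    \<open>sqrt (1 + K)\<close> in the numerator.\<close>
  have Egd: "expectation (\<lambda>\<omega>. gd \<omega> powr (- 1 / 2)) = sqrt pi * kummer_1F1 (1 / 2) 1 (- K) * sqrt (1 + K)"
    using gd_mom(2) assms
    by (simp add: powr_half_sqrt powr_minus Gamma_one_half_real field_simps)

  \<comment> \<open>Needed to split the root into powers: on negative arguments \<open>sqrt\<close>
    is odd, whereas \<open>powr\<close> is never negative.\<close>
  have AE_pos: "AE \<omega> in M. 0 < Y \<omega>" if Y: "distributed M lborel Y (erlang_mixture n m l)" for Y n m l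
  proof -
    have "AE x in lborel. 0 < erlang_mixture n m l x \<longrightarrow> 0 < x"
      using AE_lborel_singleton[of 0]
      by eventually_elim (metis erlang_mixture_neg less_irrefl linorder_neqE_linordered_idom)
    then show ?thesis
      using distributed_AE2[OF Y, of "\<lambda>x. 0 < x"] by simp
  qed
  have eq: "AE \<omega> in M. gd \<omega> powr (- 1 / 2) * S \<omega> powr (1 / 2) = sqrt (S \<omega> / gd \<omega>)"
    using AE_pos[OF S] AE_pos[OF gd]
    by eventually_elim (simp add: powr_half_sqrt powr_minus real_sqrt_divide field_simps)
  have [measurable]: "S \<in> borel_measurable M" "gd \<in> borel_measurable M"
    using distributed_measurable[OF S] distributed_measurable[OF gd] by simp_all
  have "integrable M (\<lambda>\<omega>. sqrt (S \<omega> / gd \<omega>))"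
    using indep_var_integrable[OF ind int] eq by (subst integrable_cong_AE[symmetric]) auto
  moreover have "expectation (\<lambda>\<omega>. sqrt (S \<omega> / gd \<omega>)) =
      expectation (\<lambda>\<omega>. gd \<omega> powr (- 1 / 2)) * expectation (\<lambda>\<omega>. S \<omega> powr (1 / 2))"
    using indep_var_lebesgue_integral[OF ind int] eq by (subst integral_cong_AE[symmetric]) auto
  ultimately show ?thesis
    unfolding EVM_def ES Egd by (simp add: S_def real_sqrt_divide mult_ac)
qed

end
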